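(* Let $C_n$ denote the cycle on $n\ge 3$ vertices. For $n=3$ and for every $n\geq 5$, $\mathrm{MEG}(C_n)=3$. Moreover, $\mathrm{MEG}(C_4)=4$.
   Context: Two vertices $x,y$ of a graph $G$ monitor an edge $e$ if $e$ belongs to all shortest paths between $x$ and $y$. A set $S\subseteq V(G)$ is a monitoring edge-geodetic set (MEG-set) if for every edge $e$ of $G$ there is a pair $x,y\in S$ that monitors $e$. $\mathrm{MEG}(G)$ denotes the minimum size of an MEG-set of $G$. *)

theory Defs
  imports Main
begin

text \<open>A graph is a pair of a vertex set and a set of undirected edges, each edge being
  the two-element set of its endpoints.\<close>

type_synonym 'a graph = "'a set \<times> 'a set set"

abbreviation verts :: "'a graph \<Rightarrow> 'a set" where
  "verts G \<equiv> fst G"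

abbreviation edges :: "'a graph \<Rightarrow> 'a set set" where
  "edges G \<equiv> snd G"

definition finite_simple_graph :: "'a graph \<Rightarrow> bool" where
  "finite_simple_graph G \<longleftrightarrow>
     finite (verts G) \<and> (\<forall>e\<in>edges G. e \<subseteq> verts G \<and> card e = 2)"

fun path_edges :: "'a list \<Rightarrow> 'a set list" where
  "path_edges [] = []"
| "path_edges [x] = []"
| "path_edges (x # y # zs) = {x, y} # path_edges (y # zs)"

definition path_between :: "'a graph \<Rightarrow> 'a \<Rightarrow> 'a \<Rightarrow> 'a list \<Rightarrow> bool" where
  "path_between G x y p \<longleftrightarrow>
     p \<noteq> [] \<and> hd p = x \<and> last p = y \<and> distinct p \<and>
     set p \<subseteq> verts G \<and> set (path_edges p) \<subseteq> edges G"

definition shortest_path_between :: "'a graph \<Rightarrow> 'a \<Rightarrow> 'a \<Rightarrow> 'a list \<Rightarrow> bool" where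
  "shortest_path_between G x y p \<longleftrightarrow>
     path_between G x y p \<and>
     (\<forall>q. path_between G x y q \<longrightarrow> length (path_edges p) \<le> length (path_edges q))"

text \<open>The first conjunct excludes vacuous monitoring by vertices in different components;
  it always holds in a connected graph.\<close>

definition monitors :: "'a graph \<Rightarrow> 'a \<Rightarrow> 'a \<Rightarrow> 'a set \<Rightarrow> bool" where
  "monitors G x y e \<longleftrightarrow>
     (\<exists>p. path_between G x y p) \<and>
     (\<forall>p. shortest_path_between G x y p \<longrightarrow> e \<in> set (path_edges p))"

definition MEG_set :: "'a graph \<Rightarrow> 'a set \<Rightarrow> bool" where
  "MEG_set G S \<longleftrightarrow>
     S \<subseteq> verts G \<and> (\<forall>e\<in>edges G. \<exists>x\<in>S. \<exists>y\<in>S. monitors G x y e)"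

text \<open>Finiteness of \<open>S\<close> is automatic for finite graphs; it is there because \<open>card\<close> is 0
  on infinite sets.\<close>

definition MEG :: "'a graph \<Rightarrow> nat" where
  "MEG G = (LEAST k. \<exists>S. MEG_set G S \<and> finite S \<and> card S = k)"

definition cycle_graph :: "nat \<Rightarrow> nat graph" where
  "cycle_graph n = ({..<n}, {{i, (i + 1) mod n} | i. i < n})"

lemma finite_simple_graph_cycle:
  assumes "n \<ge> 3"
  shows "finite_simple_graph (cycle_graph n)"
proof -
  have "i \<noteq> (i + 1) mod n" if "i < n" for i
    using that assms by (cases "i + 1 = n") auto
  then show ?thesis
    using assms by (auto simp: finite_simple_graph_def cycle_graph_def card_2_iff)
qed

lemma MEG_set_verts:
  assumes "finite_simple_graph G"
  shows "MEG_set G (verts G)"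
proof -
  have "\<exists>x\<in>verts G. \<exists>y\<in>verts G. monitors G x y e" if e: "e \<in> edges G" for e
  proof -
    obtain x y where xy: "e = {x, y}" "x \<noteq> y" "x \<in> verts G" "y \<in> verts G"
      using assms e unfolding finite_simple_graph_def by (metis card_2_iff insert_subset)
    have path: "path_between G x y [x, y]"
      using xy e by (simp add: path_between_def)
    have "e \<in> set (path_edges p)" if "shortest_path_between G x y p" for p
    proof -
      from that path have "length (path_edges p) \<le> 1" and p: "path_between G x y p"
        unfolding shortest_path_between_def by fastforce+
      then show ?thesis
        using xy by (cases p rule: path_edges.cases; cases "tl (tl p)")
          (auto simp: path_between_def)
    qed
    then show ?thesis
      using path xy unfolding monitors_def by blast
  qed
  then show ?thesis
    by (auto simp: MEG_set_def)
qed

end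

theory Submission imports Defs begin

text \<open>Cut the cycle at two edges, one on each of the two arcs between two vertices: the vertices
  are separated. So every path between them contains one of the two arcs entirely, and a strictly
  shorter arc is monitored by its endpoints. Three vertices cutting the cycle into arcs of length
  less than \<open>n / 2\<close> therefore suffice; they exist unless \<open>n = 4\<close>. Conversely, if all
  vertices of \<open>S\<close> lie on an arc of length at most \<open>n / 2\<close>, then any two of them
  are joined by a shortest path inside that arc, and no edge outside it is monitored. Two
  vertices always lie on such an arc, and so do three vertices of the 4-cycle.\<close>

section \<open>Edge lists of paths, reversal, and cuts in arbitrary graphs\<close>

lemma path_edges_snoc: "path_edges (p @ [a, b]) = path_edges (p @ [a]) @ [{a, b}]"
  by (induction p rule: path_edges.induct) auto

lemma path_edges_map_upt:
  "path_edges (map f [0..<Suc d]) = map (\<lambda>i. {f i, f (Suc i)}) [0..<d]"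
proof (induction d)
  case (Suc d)
  have "map f [0..<Suc (Suc d)] = map f [0..<d] @ [f d, f (Suc d)]"
    by simp
  then show ?case
    using Suc by (simp add: path_edges_snoc del: upt_Suc) simp
qed simp

lemma path_edges_rev: "path_edges (rev p) = rev (path_edges p)"
  by (induction p rule: path_edges.induct) (auto simp: path_edges_snoc insert_commute)

lemma path_between_rev: "path_between G x y p \<Longrightarrow> path_between G y x (rev p)"
  by (auto simp: path_between_def path_edges_rev hd_rev last_rev)

lemma shortest_path_between_rev:
  assumes "shortest_path_between G x y p"
  shows "shortest_path_between G y x (rev p)"
  using assms unfolding shortest_path_between_def
  by (metis length_rev path_between_rev path_edges_rev)

lemma monitors_commute: "monitors G x y e \<Longrightarrow> monitors G y x e"
  unfolding monitors_def
  by (metis path_between_rev path_edges_rev set_rev shortest_path_between_rev)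

text \<open>Meant for \<open>A\<close> one side of a cut: a walk that uses no crossing edge never
  changes sides.\<close>

lemma path_hd_in_iff_last_in:
  assumes "p \<noteq> []" and "\<And>u v. {u, v} \<in> set (path_edges p) \<Longrightarrow> u \<in> A \<longleftrightarrow> v \<in> A"
  shows "hd p \<in> A \<longleftrightarrow> last p \<in> A"
  using assms
proof (induction p rule: path_edges.induct)
  case (3 x y zs)
  have "x \<in> A \<longleftrightarrow> y \<in> A"
    by (rule 3(3)) simp
  moreover have "hd (y # zs) \<in> A \<longleftrightarrow> last (y # zs) \<in> A"
    by (rule 3(1)) (use 3(3) in auto)
  ultimately show ?case
    by simp
qed simp_all

section \<open>Numbering the vertices and edges of the cycle by offsets\<close>

definition cycle_edge :: "nat \<Rightarrow> nat \<Rightarrow> nat set" where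
  "cycle_edge n k = {k mod n, Suc k mod n}"

definition cycle_arc :: "nat \<Rightarrow> nat \<Rightarrow> nat \<Rightarrow> nat list" where
  "cycle_arc n x d = map (\<lambda>i. (x + i) mod n) [0..<Suc d]"

lemma add_mod_inj:
  fixes n x i j :: nat
  assumes "(x + i) mod n = (x + j) mod n" "i < n" "j < n"
  shows "i = j"
proof -
  have "int n dvd int i - int j"
    using assms(1) by (metis add_diff_cancel_left mod_eq_dvd_iff of_nat_add of_nat_mod)
  then show ?thesis
    using assms(2,3) by (metis mod_eq_dvd_iff mod_less of_nat_eq_iff of_nat_mod)
qed

lemma add_mod_surj:
  fixes n x i :: nat
  assumes "i < n"
  obtains j where "j < n" "i = (x + j) mod n"
proof
  \<comment> \<open>The witness is \<open>i - x\<close> modulo \<open>n\<close>, written so that no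
    subtraction is truncated.\<close>
  have "(x + (i + (n - x mod n))) mod n = (x mod n + (i + (n - x mod n))) mod n"
    by (simp add: mod_simps)
  also have "x mod n + (i + (n - x mod n)) = i + n"
    using assms mod_less_divisor[of n x] by linarith
  finally show "i = (x + (i + (n - x mod n)) mod n) mod n"
    using assms by (simp add: mod_simps)
  show "(i + (n - x mod n)) mod n < n"
    using assms by simp
qed

lemma cycle_edge_mod: "cycle_edge n (k mod n) = cycle_edge n k"
  by (simp add: cycle_edge_def mod_simps)

text \<open>Two edges with different indices could only agree with their ends swapped, which makes
  \<open>b + 2\<close> and \<open>b\<close> congruent. This does happen for
  \<open>n = 2\<close>.\<close>

lemma cycle_edge_eq_iff:
  assumes "n \<ge> 3"
  shows "cycle_edge n a = cycle_edge n b \<longleftrightarrow> a mod n = b mod n"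
proof
  assume eq: "cycle_edge n a = cycle_edge n b"
  show "a mod n = b mod n"
  proof (rule ccontr)
    assume "a mod n \<noteq> b mod n"
    then have "a mod n = Suc b mod n" "Suc a mod n = b mod n"
      using eq by (auto simp: cycle_edge_def doubleton_eq_iff)
    then have "(b + 2) mod n = (b + 0) mod n"
      by (metis add_2_eq_Suc' add_0_right mod_Suc_eq)
    then show False
      using add_mod_inj[of b 2 n 0] assms by auto
  qed
next
  assume "a mod n = b mod n"
  then show "cycle_edge n a = cycle_edge n b"
    by (metis cycle_edge_mod)
qed

lemma inj_on_cycle_edge:
  assumes "n \<ge> 3"
  shows "inj_on (\<lambda>i. cycle_edge n (x + i)) {..<n}"
  using assms by (auto simp: inj_on_def cycle_edge_eq_iff dest: add_mod_inj)

lemma verts_cycle_graph: "verts (cycle_graph n) = {..<n}"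
  by (simp add: cycle_graph_def)

text \<open>The free \<open>x\<close> lets later arguments number the edges from a vertex of their
  choice, so that an arc starting there is an initial segment of offsets.\<close>

lemma edges_cycle_graph:
  "edges (cycle_graph n) = (\<lambda>i. cycle_edge n (x + i)) ` {..<n}"
proof -
  have edges: "edges (cycle_graph n) = cycle_edge n ` {..<n}"
    by (auto simp: cycle_graph_def cycle_edge_def image_def)
  show ?thesis
  proof (intro equalityI subsetI)
    fix e assume "e \<in> edges (cycle_graph n)"
    then obtain i where i: "i < n" "e = cycle_edge n i"
      using edges by auto
    obtain j where "j < n" "i = (x + j) mod n"
      using add_mod_surj i(1) by blast
    then show "e \<in> (\<lambda>i. cycle_edge n (x + i)) ` {..<n}"
      using i by (auto simp: cycle_edge_mod)
  next
    fix e assume "e \<in> (\<lambda>i. cycle_edge n (x + i)) ` {..<n}"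
    then obtain j where "j < n" "e = cycle_edge n ((x + j) mod n)"
      by (auto simp: cycle_edge_mod)
    moreover from this have "(x + j) mod n < n"
      by simp
    ultimately show "e \<in> edges (cycle_graph n)"
      using edges by blast
  qed
qed

section \<open>Arcs as paths, shortest paths and monitored edges\<close>

lemma path_edges_cycle_arc:
  "path_edges (cycle_arc n x d) = map (\<lambda>i. cycle_edge n (x + i)) [0..<d]"
  unfolding cycle_arc_def path_edges_map_upt by (simp add: cycle_edge_def)

lemma path_between_cycle_arc:
  assumes "d < n"
  shows "path_between (cycle_graph n) (x mod n) ((x + d) mod n) (cycle_arc n x d)"
proof -
  have "hd (cycle_arc n x d) = x mod n"
    by (simp add: cycle_arc_def upt_conv_Cons del: upt_Suc)
  moreover have "last (cycle_arc n x d) = (x + d) mod n" "cycle_arc n x d \<noteq> []"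
    by (simp_all add: cycle_arc_def)
  moreover have "distinct (cycle_arc n x d)"
    using assms unfolding cycle_arc_def distinct_map
    by (auto simp: inj_on_def simp del: upt_Suc dest: add_mod_inj)
  moreover have "set (cycle_arc n x d) \<subseteq> verts (cycle_graph n)"
    using assms by (auto simp: cycle_arc_def verts_cycle_graph)
  moreover have "set (path_edges (cycle_arc n x d)) \<subseteq> edges (cycle_graph n)"
    using assms by (auto simp: path_edges_cycle_arc edges_cycle_graph[of n x])
  ultimately show ?thesis
    by (simp add: path_between_def)
qed

lemma cycle_cut:
  assumes p: "path_between (cycle_graph n) (x mod n) ((x + d) mod n) p"
    and kl: "k < d" "d \<le> l" "l < n"
  shows "cycle_edge n (x + k) \<in> set (path_edges p) \<or> cycle_edge n (x + l) \<in> set (path_edges p)"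
proof (rule ccontr)
  assume neg: "\<not> ?thesis"
  \<comment> \<open>Deleting the edges at offsets \<open>k\<close> and \<open>l\<close> splits the
    cycle in two; \<open>A\<close> is the side that contains offset \<open>d\<close> but not offset
    0.\<close>
  define A where "A = (\<lambda>j. (x + j) mod n) ` {k<..l}"
  have A: "(x + j) mod n \<in> A \<longleftrightarrow> k < j \<and> j \<le> l" if "j < n" for j
    using that kl by (auto simp: A_def dest: add_mod_inj)
  have "u \<in> A \<longleftrightarrow> v \<in> A" if uv: "{u, v} \<in> set (path_edges p)" for u v
  proof -
    have "{u, v} \<in> edges (cycle_graph n)"
      using p uv by (auto simp: path_between_def)
    then obtain j where j: "j < n" "{u, v} = cycle_edge n (x + j)"
      using edges_cycle_graph[of n x] by auto
    have "j \<noteq> k" "j \<noteq> l"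
      using j uv neg by auto
    \<comment> \<open>The edge at offset \<open>j\<close> joins offsets \<open>j\<close> and
      \<open>j + 1\<close>, so only \<open>j = k\<close> and \<open>j = l\<close> cross. If
      \<open>j + 1 = n\<close>, the edge returns to offset 0, which is outside
      \<open>A\<close>.\<close>
    then have "(x + j) mod n \<in> A \<longleftrightarrow> (x + Suc j) mod n \<in> A"
      using A[of j] A[of "Suc j"] A[of 0] j(1) kl by (cases "Suc j = n") auto
    then show ?thesis
      using j(2) by (auto simp: cycle_edge_def doubleton_eq_iff)
  qed
  then have "x mod n \<in> A \<longleftrightarrow> (x + d) mod n \<in> A"
    using p path_hd_in_iff_last_in[of p A] by (auto simp: path_between_def)
  then show False
    using A[of 0] A[of d] kl by auto
qed

lemma path_contains_arc:
  assumes "path_between (cycle_graph n) (x mod n) ((x + d) mod n) p"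
  shows "(\<lambda>i. cycle_edge n (x + i)) ` {..<d} \<subseteq> set (path_edges p) \<or>
    (\<lambda>i. cycle_edge n (x + i)) ` {d..<n} \<subseteq> set (path_edges p)"
proof (rule ccontr)
  assume "\<not> ?thesis"
  then obtain k l where "k < d" "d \<le> l" "l < n" "cycle_edge n (x + k) \<notin> set (path_edges p)"
    "cycle_edge n (x + l) \<notin> set (path_edges p)"
    unfolding image_subset_iff by (meson atLeastLessThan_iff lessThan_iff)
  then show False
    using cycle_cut[OF assms] by blast
qed

text \<open>Turns containment of an arc into a lower bound on path length, as distinct offsets below
  \<open>n\<close> give distinct edges.\<close>

lemma card_cycle_edges_le_length:
  assumes "n \<ge> 3" "I \<subseteq> {..<n}" "(\<lambda>i. cycle_edge n (x + i)) ` I \<subseteq> set es"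
  shows "card I \<le> length es"
proof -
  have "card I = card ((\<lambda>i. cycle_edge n (x + i)) ` I)"
    using inj_on_subset[OF inj_on_cycle_edge assms(2)] assms(1) by (simp add: card_image)
  also have "\<dots> \<le> card (set es)"
    using assms(3) by (simp add: card_mono)
  finally show ?thesis
    using card_length le_trans by blast
qed

text \<open>Every path contains this arc or the other one, of length \<open>n - d\<close>, and
  \<open>d\<close> is at most \<open>n - d\<close>. In the case of equality the arc is one of two
  shortest paths, which is enough to refute monitoring of edges outside it.\<close>

lemma shortest_path_between_cycle_arc:
  assumes "n \<ge> 3" "2 * d \<le> n"
  shows "shortest_path_between (cycle_graph n) (x mod n) ((x + d) mod n) (cycle_arc n x d)"
  unfolding shortest_path_between_def
proof (intro conjI allI impI)
  show "path_between (cycle_graph n) (x mod n) ((x + d) mod n) (cycle_arc n x d)"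
    using assms by (intro path_between_cycle_arc) simp
next
  fix q assume "path_between (cycle_graph n) (x mod n) ((x + d) mod n) q"
  from path_contains_arc[OF this] have "d \<le> length (path_edges q)"
    using assms card_cycle_edges_le_length[of n "{..<d}" x]
      card_cycle_edges_le_length[of n "{d..<n}" x] by force
  then show "length (path_edges (cycle_arc n x d)) \<le> length (path_edges q)"
    by (simp add: path_edges_cycle_arc)
qed

lemma monitors_cycle_arc:
  assumes "n \<ge> 3" "2 * d < n" "i < d"
  shows "monitors (cycle_graph n) (x mod n) ((x + d) mod n) (cycle_edge n (x + i))"
  unfolding monitors_def
proof (intro conjI exI allI impI)
  show "path_between (cycle_graph n) (x mod n) ((x + d) mod n) (cycle_arc n x d)"
    using assms by (intro path_between_cycle_arc) simp
next
  fix p assume p: "shortest_path_between (cycle_graph n) (x mod n) ((x + d) mod n) p"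
  have "length (path_edges p) \<le> length (path_edges (cycle_arc n x d))"
    using p path_between_cycle_arc[of d n x] assms by (auto simp: shortest_path_between_def)
  \<comment> \<open>This is where the strict inequality enters: a shortest path is too short to
    contain the complementary arc.\<close>
  then have "length (path_edges p) < n - d"
    using assms by (simp add: path_edges_cycle_arc)
  then have "\<not> (\<lambda>i. cycle_edge n (x + i)) ` {d..<n} \<subseteq> set (path_edges p)"
    using assms(1) card_cycle_edges_le_length[of n "{d..<n}" x "path_edges p"] by fastforce
  then show "cycle_edge n (x + i) \<in> set (path_edges p)"
    using path_contains_arc[of n x d p] p assms(3) by (auto simp: shortest_path_between_def)
qed

section \<open>Lower bounds\<close>

lemma monitored_edge_in_arc:
  assumes "n \<ge> 3" "2 * d \<le> n" "monitors (cycle_graph n) (x mod n) ((x + d) mod n) e"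
  shows "\<exists>i<d. e = cycle_edge n (x + i)"
proof -
  have "e \<in> set (path_edges (cycle_arc n x d))"
    using shortest_path_between_cycle_arc[OF assms(1,2), of x] assms(3)
    unfolding monitors_def by blast
  then show ?thesis
    by (auto simp: path_edges_cycle_arc)
qed

lemma not_MEG_set_if_in_half_arc:
  assumes n: "n \<ge> 3" "2 * d \<le> n" and S: "S \<subseteq> (\<lambda>j. (x + j) mod n) ` {..d}"
  shows "\<not> MEG_set (cycle_graph n) S"
proof
  assume "MEG_set (cycle_graph n) S"
  \<comment> \<open>The first edge beyond the arc is the one that stays unmonitored.\<close>
  moreover have "cycle_edge n (x + d) \<in> edges (cycle_graph n)"
    using n by (auto simp: edges_cycle_graph[of n x])
  ultimately obtain u v where uv: "u \<in> S" "v \<in> S"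
    "monitors (cycle_graph n) u v (cycle_edge n (x + d))"
    by (auto simp: MEG_set_def)
  obtain a b where ab: "a \<le> d" "b \<le> d" "u = (x + a) mod n" "v = (x + b) mod n"
    using S uv(1,2) by (meson atMost_iff imageE subsetD)
  \<comment> \<open>By symmetry of monitoring the pair can be ordered along the arc, so that the
    subarc from \<open>a\<close> to \<open>b\<close> stays within offsets up to
    \<open>d\<close>.\<close>
  have "\<exists>a b. a \<le> b \<and> b \<le> d \<and>
      monitors (cycle_graph n) ((x + a) mod n) ((x + b) mod n) (cycle_edge n (x + d))"
    using ab uv(3) monitors_commute nle_le by metis
  then obtain a b where ab: "a \<le> b" "b \<le> d" and mon:
    "monitors (cycle_graph n) ((x + a) mod n) ((x + b) mod n) (cycle_edge n (x + d))"
    by blast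
  have "2 * (b - a) \<le> n"
    using ab n by linarith
  then obtain i where i: "i < b - a" "cycle_edge n (x + d) = cycle_edge n (x + (a + i))"
    using monitored_edge_in_arc[of n "b - a" "x + a" "cycle_edge n (x + d)"] mon n ab
    by (auto simp: add.assoc)
  have "a + i < d" "d < n"
    using i(1) ab n by linarith+
  moreover have "(x + d) mod n = (x + (a + i)) mod n"
    using i(2) cycle_edge_eq_iff n(1) by blast
  ultimately show False
    using add_mod_inj[of x d n "a + i"] by linarith
qed

text \<open>The arcs from \<open>u\<close> to \<open>v\<close> and from \<open>v\<close> to
  \<open>u\<close> have lengths \<open>d\<close> and \<open>n - d\<close>, so one of them is at most
  half the cycle.\<close>

lemma two_vertices_in_half_arc:
  fixes n u v :: nat
  assumes "u < n" "v < n"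
  shows "\<exists>x d. 2 * d \<le> n \<and> {u, v} \<subseteq> (\<lambda>j. (x + j) mod n) ` {..d}"
proof -
  have arc: "{w, (w + d) mod n} \<subseteq> (\<lambda>j. (w + j) mod n) ` {..d}" if "w < n" for w d
    using that image_eqI[of w "\<lambda>j. (w + j) mod n" 0 "{..d}"] by auto
  obtain d where d: "d < n" "v = (u + d) mod n"
    using add_mod_surj assms(2) by blast
  show ?thesis
  proof (cases "2 * d \<le> n")
    case True
    then show ?thesis
      using arc d assms by blast
  next
    case False
    have "(v + (n - d)) mod n = (u + (d + (n - d))) mod n"
      unfolding d(2) by (simp only: mod_add_left_eq add.assoc)
    then have "(v + (n - d)) mod n = u"
      using d(1) assms(1) by simp
    moreover have "2 * (n - d) \<le> n"
      using False by simp
    ultimately show ?thesis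
      using arc[of v "n - d"] assms by (metis insert_commute)
  qed
qed

lemma card_MEG_set_cycle_ge_3:
  assumes "n \<ge> 3" "MEG_set (cycle_graph n) S"
  shows "3 \<le> card S"
proof (rule ccontr)
  assume "\<not> 3 \<le> card S"
  have S: "S \<subseteq> {..<n}"
    using assms(2) by (simp add: MEG_set_def verts_cycle_graph)
  then have "finite S"
    by (rule finite_subset) simp
  consider "card S = 0" | "card S = 1" | "card S = 2"
    using \<open>\<not> 3 \<le> card S\<close> by linarith
  \<comment> \<open>Smaller sets are padded to a pair, possibly with \<open>u = v\<close>.\<close>
  then have "\<exists>u v. u < n \<and> v < n \<and> S \<subseteq> {u, v}"
  proof cases
    case 1
    then show ?thesis
      using \<open>finite S\<close> assms(1) by (auto intro!: exI[of _ 0])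
  next
    case 2
    then show ?thesis
      using S by (auto simp: card_1_singleton_iff)
  next
    case 3
    then show ?thesis
      using S by (auto simp: card_2_iff)
  qed
  then obtain x d where "2 * d \<le> n" "S \<subseteq> (\<lambda>j. (x + j) mod n) ` {..d}"
    using two_vertices_in_half_arc subset_trans by metis
  then show False
    using not_MEG_set_if_in_half_arc assms by blast
qed

lemma card_MEG_set_cycle_4_ge_4:
  assumes "MEG_set (cycle_graph 4) S"
  shows "4 \<le> card S"
proof (rule ccontr)
  assume "\<not> 4 \<le> card S"
  have S: "S \<subseteq> {..<4}"
    using assms by (simp add: MEG_set_def verts_cycle_graph)
  then obtain v where v: "v < 4" "v \<notin> S"
    using \<open>\<not> 4 \<le> card S\<close> by (metis card_lessThan lessThan_iff order_refl subsetI subset_antisym)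
  \<comment> \<open>Removing \<open>v\<close> leaves an arc of length 2 that starts at its
    successor, exactly half of the 4-cycle.\<close>
  have "S \<subseteq> (\<lambda>j. (Suc v + j) mod 4) ` {..2}"
  proof
    fix u assume "u \<in> S"
    then have "u < 4" "u \<noteq> v"
      using S v by auto
    obtain j where j: "j < 4" "u = (Suc v + j) mod 4"
      using add_mod_surj \<open>u < 4\<close> by blast
    \<comment> \<open>Offset 3 from the successor of \<open>v\<close> is \<open>v\<close>
      itself.\<close>
    have "j \<noteq> 3"
      using j \<open>u \<noteq> v\<close> v by auto
    then show "u \<in> (\<lambda>j. (Suc v + j) mod 4) ` {..2}"
      using j by auto
  qed
  then show False
    using not_MEG_set_if_in_half_arc[of 4 2 S "Suc v"] assms by simp
qed

section \<open>Optimal sets and the theorem\<close>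

lemma MEG_set_cycle:
  fixes n :: nat
  assumes "n = 3 \<or> n \<ge> 5"
  defines "h \<equiv> (n - 1) div 2"
  shows "MEG_set (cycle_graph n) {0, h, 2 * h}"
  unfolding MEG_set_def
proof (intro conjI ballI)
  \<comment> \<open>\<open>h\<close> is the largest length below \<open>n / 2\<close>. The third arc
    has length 1 for odd \<open>n\<close> and 2 for even \<open>n\<close>; the latter is below
    \<open>n / 2\<close> only if \<open>n > 4\<close>.\<close>
  have n: "n \<ge> 3" "0 < h" "2 * h < n" "2 * (n - 2 * h) < n"
    using assms by auto
  show "{0, h, 2 * h} \<subseteq> verts (cycle_graph n)"
    using n by (auto simp: verts_cycle_graph)
  fix e assume "e \<in> edges (cycle_graph n)"
  then obtain i where i: "i < n" "e = cycle_edge n i"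
    using edges_cycle_graph[of n 0] by auto
  consider "i < h" | "h \<le> i" "i < 2 * h" | "2 * h \<le> i"
    by linarith
  then show "\<exists>x\<in>{0, h, 2 * h}. \<exists>y\<in>{0, h, 2 * h}. monitors (cycle_graph n) x y e"
  proof cases
    case 1
    then have "monitors (cycle_graph n) 0 h e"
      using monitors_cycle_arc[of n h i 0] n i by simp
    then show ?thesis
      by blast
  next
    case 2
    then have "monitors (cycle_graph n) h (2 * h) e"
      using monitors_cycle_arc[of n h "i - h" h] n i by (simp add: mult_2)
    then show ?thesis
      by blast
  next
    case 3
    \<comment> \<open>The last arc closes the cycle: its end offset
      \<open>2 * h + (n - 2 * h)\<close> is 0 modulo \<open>n\<close>.\<close>
    then have "monitors (cycle_graph n) (2 * h) 0 e"
      using monitors_cycle_arc[of n "n - 2 * h" "i - 2 * h" "2 * h"] n i by simp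
    then show ?thesis
      by blast
  qed
qed

theorem theorem2:
  "(\<forall>n::nat. n = 3 \<or> n \<ge> 5 \<longrightarrow> MEG (cycle_graph n) = 3) \<and> MEG (cycle_graph 4) = 4"
proof (intro conjI allI impI)
  fix n :: nat
  assume n: "n = 3 \<or> n \<ge> 5"
  define h where "h = (n - 1) div 2"
  have "h > 0"
    using n by (auto simp: h_def)
  then have "card {0, h, 2 * h} = 3"
    by simp
  moreover have "MEG_set (cycle_graph n) {0, h, 2 * h}"
    unfolding h_def by (rule MEG_set_cycle[OF n])
  moreover have "3 \<le> card S" if "MEG_set (cycle_graph n) S" for S
    using card_MEG_set_cycle_ge_3[OF _ that] n by linarith
  ultimately show "MEG (cycle_graph n) = 3"
    unfolding MEG_def by (intro Least_equality) (blast intro: finite.intros)+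
next
  \<comment> \<open>All vertices together always suffice, since every edge is monitored by its own
    ends.\<close>
  have "MEG_set (cycle_graph 4) {..<4}"
    using MEG_set_verts[OF finite_simple_graph_cycle[of 4]] by (simp add: verts_cycle_graph)
  then show "MEG (cycle_graph 4) = 4"
    unfolding MEG_def using card_MEG_set_cycle_4_ge_4
    by (intro Least_equality) (auto intro!: exI[of _ "{..<4}"])
qed

end
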